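(* Let $\rho_0 \in [0,\tfrac12]$ and let $X_1, X_2, \ldots$ be i.i.d. random variables with $\mathbb{P}(X_i = 0) = \rho_0$ and $\mathbb{P}(X_i = 1) = \mathbb{P}(X_i = -1) = \frac{1-\rho_0}{2}$. For $p \ge 1$ and $a = (a_1,\ldots,a_n) \in \mathbb{R}^n$, let $N_p(a) = \left(\mathbb{E}\left|\sum_{i=1}^n a_i X_i\right|^p\right)^{1/p}$. If $p \geq 3$, then the best (i.e. smallest) constant $C_p$ such that the inequality $N_p(a) \leq C_p N_2(a)$ holds for all positive integers $n$ and all $a \in \mathbb{R}^n$ is $C_p = \|G\|_p$, where $G$ is a standard Gaussian random variable.
   Context: For a random variable $Z$, $\|Z\|_p = (\mathbb{E}|Z|^p)^{1/p}$. A standard Gaussian random variable $G$ has density $\frac{1}{\sqrt{2\pi}}e^{-x^2/2}$ on $\mathbb{R}$, and $\|G\|_p = 2^{1/2}\left(\pi^{-1/2}\Gamma\left((p+1)/2\right)\right)^{1/p}$. *)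

theory Defs
  imports "HOL-Probability.Probability"
begin

text \<open>The norm is meaningful only where \<open>\<bar>Z\<bar> powr p\<close> is integrable: otherwise the Bochner integral,
  and hence this quantity, is 0. Finite linear combinations of bounded random variables and Gaussian
  random variables have finite moments of every order.\<close>

definition lp_norm :: "'a measure \<Rightarrow> real \<Rightarrow> ('a \<Rightarrow> real) \<Rightarrow> real" where
  "lp_norm M p Z = (\<integral>\<omega>. \<bar>Z \<omega>\<bar> powr p \<partial>M) powr (1 / p)"

text \<open>A vector of $\mathbb{R}^n$ is the restriction of \<open>a\<close> to the indices \<open>1, ..., n\<close>.\<close>

definition N_norm :: "'a measure \<Rightarrow> (nat \<Rightarrow> 'a \<Rightarrow> real) \<Rightarrow> real \<Rightarrow> nat \<Rightarrow> (nat \<Rightarrow> real) \<Rightarrow> real" where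
  "N_norm M X p n a = lp_norm M p (\<lambda>\<omega>. \<Sum>i=1..n. a i * X i \<omega>)"

definition khinchine_constant :: "'a measure \<Rightarrow> (nat \<Rightarrow> 'a \<Rightarrow> real) \<Rightarrow> real \<Rightarrow> real \<Rightarrow> bool" where
  "khinchine_constant M X p C \<longleftrightarrow> (\<forall>n\<ge>1. \<forall>a. N_norm M X p n a \<le> C * N_norm M X 2 n a)"

definition best_khinchine_constant :: "'a measure \<Rightarrow> (nat \<Rightarrow> 'a \<Rightarrow> real) \<Rightarrow> real \<Rightarrow> real \<Rightarrow> bool" where
  "best_khinchine_constant M X p C \<longleftrightarrow>
     khinchine_constant M X p C \<and> (\<forall>C'. khinchine_constant M X p C' \<longrightarrow> C \<le> C')"

end

theory Submission
  imports Defs "HOL-Real_Asymp.Real_Asymp"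
begin

text \<open>Let \<open>f y = max 0 y ^ 3\<close>, let \<open>G\<close> be a standard Gaussian variable and let \<open>\<sigma>\<^sup>2 = 1 - \<rho>\<^sub>0\<close> be the
  variance of the \<open>X i\<close>. The upper bound replaces the summands \<open>a i * X i\<close> by Gaussian variables of the same
  variance one at a time, which increases \<open>E f (S - t)\<close> for every real \<open>t\<close>. For a single summand this
  means \<open>E f (a * X - t) \<le> E f (a * \<sigma> * G - t)\<close>, which after scaling reduces to the extreme case
  \<open>\<rho>\<^sub>0 = 1 / 2\<close>. For \<open>p > 3\<close>, \<open>\<bar>y\<bar> powr p\<close> is a positive mixture over \<open>t \<ge> 0\<close> of the functions
  \<open>f (y - t) + f (- y - t)\<close>, and for \<open>p = 3\<close> it is the one with \<open>t = 0\<close>. Optimality follows from the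
  central limit theorem for equal coefficients.\<close>

section \<open>Truncated cubic moments of the Gaussian law\<close>

definition normal_tail :: "real \<Rightarrow> real" where
  "normal_tail u = 1 - cdf std_normal_distribution u"

text \<open>A closed form of \<open>E (max 0 (G - u)) ^ 3\<close> for a standard Gaussian
  \<open>G\<close>, as \<open>nn_integral_cube_part_std_normal\<close> confirms. The explicit
  expression gives access to its first three derivatives.\<close>

definition gauss_cube :: "real \<Rightarrow> real" where
  "gauss_cube u = (u\<^sup>2 + 2) * std_normal_density u - (u ^ 3 + 3 * u) * normal_tail u"

interpretation std_normal: real_distribution std_normal_distribution
  by (rule real_dist_normal_dist)

lemma std_normal_density_deriv:
  "(std_normal_density has_real_derivative - u * std_normal_density u) (at u)"
  unfolding std_normal_density_def by (rule derivative_eq_intros refl | simp)+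

lemma std_normal_density_minus: "std_normal_density (- u) = std_normal_density u"
  by (simp add: std_normal_density_def)

lemma measure_std_normal_Ioc:
  "measure std_normal_distribution {a<..b} = integral {a..b} std_normal_density"
proof -
  have i: "(std_normal_density has_integral (integral {a..b} std_normal_density)) {a..b}"
    unfolding std_normal_density_def
    by (intro integrable_integral integrable_continuous_real continuous_intros) auto
  have "emeasure std_normal_distribution {a<..b} = (\<integral>\<^sup>+x\<in>{a<..b}. std_normal_density x \<partial>lborel)"
    by (subst emeasure_density) auto
  also have "\<dots> = (\<integral>\<^sup>+x\<in>{a..b}. std_normal_density x \<partial>lborel)"
  proof (rule nn_integral_cong_AE)
    show "AE x in lborel. ennreal (std_normal_density x) * indicator {a<..b} x =
        ennreal (std_normal_density x) * indicator {a..b} x"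
      using AE_lborel_singleton[of a] by eventually_elim (simp add: indicator_def)
  qed
  also have "\<dots> = ennreal (integral {a..b} std_normal_density)"
    by (intro nn_integral_has_integral_lebesgue' i) auto
  finally show ?thesis
    using i by (simp add: measure_def has_integral_nonneg[OF i])
qed

lemma normal_tail_deriv:
  "(normal_tail has_real_derivative - std_normal_density u) (at u)"
proof -
  \<comment> \<open>The fundamental theorem of calculus is applied on a compact interval, so near
    \<open>u\<close> the cdf is written as its value at \<open>u - 1\<close> plus an integral. The
    base point only has to lie to the left of \<open>u\<close>.\<close>
  have cont: "continuous_on {u - 1..u + 1} std_normal_density"
    unfolding std_normal_density_def by (intro continuous_intros) auto
  have "((\<lambda>x. integral {u - 1..x} std_normal_density) has_real_derivative std_normal_density u)
      (at u within {u - 1..u + 1})"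
    by (rule integral_has_real_derivative[OF cont]) auto
  then have d: "((\<lambda>x. integral {u - 1..x} std_normal_density) has_real_derivative std_normal_density u) (at u)"
    by (simp add: at_within_Icc_at)
  have "((\<lambda>x. 1 - (cdf std_normal_distribution (u - 1) + integral {u - 1..x} std_normal_density))
      has_real_derivative - std_normal_density u) (at u)"
    by (auto intro!: derivative_eq_intros d)
  moreover have "\<forall>\<^sub>F x in nhds u. normal_tail x =
      1 - (cdf std_normal_distribution (u - 1) + integral {u - 1..x} std_normal_density)"
  proof -
    have "\<forall>\<^sub>F x in nhds u. x > u - 1"
      using eventually_nhds_in_open[of "{u - 1<..}" u] by simp
    then show ?thesis
    proof eventually_elim
      case (elim x)
      then show ?case
        using std_normal.cdf_diff_eq[of "u - 1" x]
        by (simp add: normal_tail_def measure_std_normal_Ioc[symmetric])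
    qed
  qed
  ultimately show ?thesis
    by (subst DERIV_cong_ev) auto
qed

lemma normal_tail_at_top: "(normal_tail \<longlongrightarrow> 0) at_top"
  unfolding normal_tail_def[abs_def]
  by (rule tendsto_eq_intros std_normal.cdf_lim_at_top_prob refl)+ simp

text \<open>The density is even, so \<open>normal_tail u + normal_tail (- u)\<close> has derivative
  0; being constant, it equals its limit 1 at infinity.\<close>

lemma normal_tail_minus: "normal_tail (- u) = 1 - normal_tail u"
proof -
  define h where "h = (\<lambda>u. normal_tail u + normal_tail (- u))"
  have "(h has_real_derivative 0) (at x)" for x
    unfolding h_def
    by (auto intro!: derivative_eq_intros normal_tail_deriv DERIV_chain2[OF normal_tail_deriv]
        simp: std_normal_density_minus)
  then have "h x = h u" for x
    using DERIV_const_ratio_const[of x u h 0] by (cases "x = u") auto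
  then have h: "h = (\<lambda>_. h u)" by auto
  have "((\<lambda>x. cdf std_normal_distribution (- x)) \<longlongrightarrow> 0) at_top"
    using filterlim_compose[OF std_normal.cdf_lim_at_bot filterlim_uminus_at_bot_at_top] by simp
  then have "((\<lambda>x. normal_tail x + (1 - cdf std_normal_distribution (- x))) \<longlongrightarrow> 0 + (1 - 0)) at_top"
    by (intro tendsto_intros normal_tail_at_top)
  then have "(h \<longlongrightarrow> 1) at_top" by (simp add: h_def normal_tail_def[of "- _"])
  then have "h u = 1"
    by (subst (asm) h) (simp add: tendsto_const_iff)
  then show ?thesis by (simp add: h_def)
qed

text \<open>The polynomial is \<open>E (G + u) ^ 3\<close>: take expectations in
  \<open>max 0 y ^ 3 = y ^ 3 + max 0 (- y) ^ 3\<close> at \<open>y = G + u\<close> and use that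
  \<open>- G\<close> has the law of \<open>G\<close>.\<close>

lemma gauss_cube_minus: "gauss_cube (- u) = gauss_cube u + u ^ 3 + 3 * u"
  by (simp add: gauss_cube_def normal_tail_minus std_normal_density_minus algebra_simps)

lemma gauss_cube_deriv:
  "(gauss_cube has_real_derivative 3 * u * std_normal_density u - (3 * u\<^sup>2 + 3) * normal_tail u) (at u)"
  unfolding gauss_cube_def[abs_def]
  by (auto intro!: derivative_eq_intros std_normal_density_deriv normal_tail_deriv)
     (simp add: algebra_simps power2_eq_square power3_eq_cube)

lemma gauss_cube_deriv2:
  "((\<lambda>u. 3 * u * std_normal_density u - (3 * u\<^sup>2 + 3) * normal_tail u) has_real_derivative
     6 * (std_normal_density u - u * normal_tail u)) (at u)"
  by (auto intro!: derivative_eq_intros std_normal_density_deriv normal_tail_deriv)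
     (simp add: algebra_simps power2_eq_square power3_eq_cube)

lemma gauss_cube_deriv3:
  "((\<lambda>u. 6 * (std_normal_density u - u * normal_tail u)) has_real_derivative - 6 * normal_tail u) (at u)"
  by (auto intro!: derivative_eq_intros std_normal_density_deriv normal_tail_deriv)

text \<open>The classical lower bound for the Mills ratio. The difference of the two sides is
  strictly decreasing and tends to 0 at infinity, so it is positive.\<close>

lemma normal_tail_gt: "u * std_normal_density u / (1 + u\<^sup>2) < normal_tail u"
proof -
  define R where "R u = normal_tail u - u * std_normal_density u / (1 + u\<^sup>2)" for u
  have [simp]: "1 + x\<^sup>2 \<noteq> 0" for x :: real
    by (metis power_one sum_power2_eq_zero_iff zero_neq_one)
  have d: "(R has_real_derivative - 2 * std_normal_density x / (1 + x\<^sup>2)\<^sup>2) (at x)" for x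
    unfolding R_def[abs_def]
    by (rule derivative_eq_intros std_normal_density_deriv normal_tail_deriv refl | simp)+
       (simp add: divide_simps, simp add: algebra_simps power2_eq_square)
  have "((\<lambda>u. u * std_normal_density u / (1 + u\<^sup>2)) \<longlongrightarrow> 0) at_top"
    unfolding std_normal_density_def by real_asymp
  then have "(R \<longlongrightarrow> 0 - 0) at_top"
    unfolding R_def[abs_def] by (intro tendsto_intros normal_tail_at_top)
  then have "0 < R u"
    using d normal_density_pos[of 1 0]
    by (intro DERIV_neg_imp_decreasing_at_top[of u R]) (auto intro!: exI simp: divide_neg_pos zero_less_power2)
  then show ?thesis by (simp add: R_def)
qed

definition cube_part :: "real \<Rightarrow> real" where
  "cube_part y = (max 0 y) ^ 3"

lemma cube_part_nonneg [simp]: "0 \<le> cube_part y"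
  by (simp add: cube_part_def)

lemma cube_part_measurable [measurable]: "cube_part \<in> borel_measurable borel"
  unfolding cube_part_def[abs_def] by measurable

lemma cube_part_mono: "x \<le> y \<Longrightarrow> cube_part x \<le> cube_part y"
  unfolding cube_part_def by (intro power_mono) auto

lemma cube_part_scale: "0 \<le> c \<Longrightarrow> cube_part (c * y) = c ^ 3 * cube_part y"
  by (simp add: cube_part_def max_mult_distrib_left flip: power_mult_distrib)

lemma cube_part_minus: "cube_part (- y) = cube_part y - y ^ 3"
  by (auto simp: cube_part_def max_def)

lemma
  shows nn_integral_cube_part_std_normal: "(\<integral>\<^sup>+x. cube_part (x - u) \<partial>std_normal_distribution) = gauss_cube u"
    and gauss_cube_nonneg: "0 \<le> gauss_cube u"
proof -
  \<comment> \<open>An antiderivative of \<open>(y - u) ^ 3 * std_normal_density y\<close>, with one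
    summand for each term of the expanded cube. It tends to 0 at infinity and equals
    \<open>- gauss_cube u\<close> at \<open>y = u\<close>; its monotonicity for
    \<open>y \<ge> u\<close> gives the nonnegativity.\<close>
  define F where "F y = - (y\<^sup>2 + 2) * std_normal_density y
    + 3 * u * (y * std_normal_density y + normal_tail y)
    - 3 * u\<^sup>2 * std_normal_density y + u ^ 3 * normal_tail y" for y
  have d: "(F has_real_derivative (y - u) ^ 3 * std_normal_density y) (at y)" for y
    unfolding F_def[abs_def]
    by (auto intro!: derivative_eq_intros std_normal_density_deriv normal_tail_deriv)
       (simp add: algebra_simps power2_eq_square power3_eq_cube)
  have lim: "(F \<longlongrightarrow> 0) at_top"
  proof -
    have "((\<lambda>y. - (y\<^sup>2 + 2) * std_normal_density y + 3 * u * (y * std_normal_density y)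
        - 3 * u\<^sup>2 * std_normal_density y) \<longlongrightarrow> 0) at_top"
      unfolding std_normal_density_def by real_asymp
    then have "((\<lambda>y. (- (y\<^sup>2 + 2) * std_normal_density y + 3 * u * (y * std_normal_density y)
        - 3 * u\<^sup>2 * std_normal_density y) + (3 * u + u ^ 3) * normal_tail y) \<longlongrightarrow> 0 + (3 * u + u ^ 3) * 0) at_top"
      by (intro tendsto_intros normal_tail_at_top)
    then show ?thesis by (simp add: F_def[abs_def] algebra_simps)
  qed
  have Fu: "- F u = gauss_cube u"
    by (simp add: F_def gauss_cube_def algebra_simps power2_eq_square power3_eq_cube)
  have "(\<integral>\<^sup>+x. cube_part (x - u) \<partial>std_normal_distribution)
      = (\<integral>\<^sup>+y. ennreal ((y - u) ^ 3 * std_normal_density y) * indicator {u..} y \<partial>lborel)"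
    by (subst nn_integral_density)
       (auto intro!: nn_integral_cong simp: cube_part_def max_def ennreal_mult'[symmetric] mult.commute
         split: split_indicator)
  also have "\<dots> = ennreal (0 - F u)"
    by (rule nn_integral_FTC_atLeast[OF _ d _ lim]) auto
  finally show "(\<integral>\<^sup>+x. cube_part (x - u) \<partial>std_normal_distribution) = gauss_cube u"
    using Fu by simp
  have "F u \<le> F y" if "u \<le> y" for y
    using d that by (intro DERIV_nonneg_imp_nondecreasing[of u y F]) (auto intro!: exI)
  then have "F u \<le> 0"
    by (intro tendsto_lowerbound[OF lim]) (auto intro: eventually_mono[OF eventually_ge_at_top[of u]])
  then show "0 \<le> gauss_cube u" using Fu by simp
qed

lemma normal_tail_strict_antimono: "a < b \<Longrightarrow> normal_tail b < normal_tail a"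
  by (rule DERIV_neg_imp_decreasing) (auto intro!: exI normal_tail_deriv normal_density_pos)

text \<open>The comparison for one summand in the extreme case: for \<open>\<rho> = 1 / 2\<close>
  the variable \<open>sqrt 2 * X\<close> has variance 1, and its only value that can exceed
  \<open>u \<ge> 0\<close> is \<open>sqrt 2\<close>, taken with probability 1/4.\<close>

lemma gauss_cube_ge:
  assumes "0 \<le> u"
  shows "cube_part (sqrt 2 - u) / 4 \<le> gauss_cube u"
proof (rule ccontr)
  \<comment> \<open>If the difference \<open>D\<close> of the two sides were negative somewhere on \<open>[0, sqrt 2]\<close>, then
    \<open>D'\<close>, which vanishes at 0, would take the signs \<open>-, +, -\<close> in this order, hence so would \<open>D''\<close>. This is
    impossible because \<open>D''\<close> is convex.\<close>
  define D where "D v = gauss_cube v - (sqrt 2 - v) ^ 3 / 4" for v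
  define D1 where "D1 v = (3 * v * std_normal_density v - (3 * v\<^sup>2 + 3) * normal_tail v)
    + 3 / 4 * (sqrt 2 - v)\<^sup>2" for v
  define D2 where "D2 v = 6 * (std_normal_density v - v * normal_tail v) - 3 / 2 * (sqrt 2 - v)" for v
  define D3 where "D3 v = - 6 * normal_tail v + 3 / 2" for v
  have d: "(D has_real_derivative D1 v) (at v)" for v
  proof -
    have "((\<lambda>v. (sqrt 2 - v) ^ 3 / 4) has_real_derivative - (3 / 4 * (sqrt 2 - v)\<^sup>2)) (at v)"
      by (rule derivative_eq_intros refl | simp)+
    from DERIV_diff[OF gauss_cube_deriv this] show ?thesis
      unfolding D_def[abs_def] D1_def by simp
  qed
  have d1: "(D1 has_real_derivative D2 v) (at v)" for v
  proof -
    have "((\<lambda>v. 3 / 4 * (sqrt 2 - v)\<^sup>2) has_real_derivative - (3 / 2 * (sqrt 2 - v))) (at v)"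
      by (rule derivative_eq_intros refl | simp add: field_simps)+
    from DERIV_add[OF gauss_cube_deriv2 this] show ?thesis
      unfolding D1_def[abs_def] D2_def by simp
  qed
  have d2: "(D2 has_real_derivative D3 v) (at v)" for v
  proof -
    have "((\<lambda>v. 3 / 2 * (sqrt 2 - v)) has_real_derivative - (3 / 2)) (at v)"
      by (rule derivative_eq_intros refl | simp)+
    from DERIV_diff[OF gauss_cube_deriv3 this] show ?thesis
      unfolding D2_def[abs_def] D3_def by simp
  qed
  assume "\<not> ?thesis"
  then have *: "gauss_cube u < cube_part (sqrt 2 - u) / 4" by simp
  \<comment> \<open>From \<open>sqrt 2\<close> on the left-hand side vanishes, so the counterexample
    \<open>u\<close> lies below; there the smooth function \<open>D\<close>, which has no
    truncation, is the right-hand side minus the left-hand side.\<close>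
  have u2: "u < sqrt 2"
  proof (rule ccontr)
    assume "\<not> u < sqrt 2"
    then have "cube_part (sqrt 2 - u) = 0" by (simp add: cube_part_def)
    with * gauss_cube_nonneg[of u] show False by simp
  qed
  with * have Du: "D u < 0" by (simp add: D_def cube_part_def)
  have tail0: "normal_tail 0 = 1 / 2" using normal_tail_minus[of 0] by simp
  have D0: "D 0 > 0"
  proof -
    \<comment> \<open>\<open>D 0 = 2 / sqrt (2 * pi) - sqrt 2 / 2\<close>, which is positive because
      \<open>pi < 4\<close>.\<close>
    have "sqrt 2 * sqrt (2 * pi) < 4"
      using pi_less_4 by (simp add: real_sqrt_mult[symmetric] real_sqrt_less_iff[of "4 * pi" 16, simplified])
    then show ?thesis
      by (simp add: D_def gauss_cube_def std_normal_density_def field_simps power3_eq_cube)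
  qed
  have D1_0: "D1 0 = 0" by (simp add: D1_def tail0)
  have D_end: "D (sqrt 2) \<ge> 0" by (simp add: D_def gauss_cube_nonneg)
  have u0: "0 < u" using assms D0 Du by (cases "u = 0") auto
  obtain a where a: "0 < a" "a < u" "D1 a < 0"
  proof -
    obtain a where "0 < a" "a < u" "D u - D 0 = (u - 0) * D1 a"
      using MVT2[OF u0, of D D1] d by blast
    moreover from this D0 Du have "D1 a < 0"
      by (metis diff_less_0_iff_less less_trans diff_zero u0 mult_less_0_iff not_less_iff_gr_or_eq)
    ultimately show thesis using that by blast
  qed
  obtain b where b: "u < b" "b < sqrt 2" "D1 b > 0"
  proof -
    obtain b where "u < b" "b < sqrt 2" "D (sqrt 2) - D u = (sqrt 2 - u) * D1 b"
      using MVT2[OF u2, of D D1] d by blast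
    moreover from this D_end Du u2 have "D1 b > 0"
      by (metis diff_gt_0_iff_gt less_le_trans zero_less_mult_pos)
    ultimately show thesis using that by blast
  qed
  \<comment> \<open>At \<open>sqrt 2\<close> the quadratic term of \<open>D1\<close> vanishes, and
    the Mills ratio bound at this point is exactly the claim.\<close>
  have D1_end: "D1 (sqrt 2) < 0"
    using normal_tail_gt[of "sqrt 2"] by (simp add: D1_def)
  obtain c1 where c1: "0 < c1" "c1 < a" "D2 c1 < 0"
    using MVT2[of 0 a D1 D2] d1 D1_0 a by (auto simp: mult_less_0_iff)
  obtain c2 where c2: "a < c2" "c2 < b" "D2 c2 > 0"
  proof -
    obtain c where c: "a < c" "c < b" "D1 b - D1 a = (b - a) * D2 c"
      using MVT2[of a b D1 D2] d1 a b by force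
    with a b have "0 < (b - a) * D2 c" by linarith
    with c show thesis using that[of c] by (auto simp: zero_less_mult_iff)
  qed
  obtain c3 where c3: "b < c3" "D2 c3 < 0"
  proof -
    obtain c where c: "b < c" "c < sqrt 2" "D1 (sqrt 2) - D1 b = (sqrt 2 - b) * D2 c"
      using MVT2[of b "sqrt 2" D1 D2] d1 b by force
    with D1_end b have "0 > (sqrt 2 - b) * D2 c" by linarith
    with c show thesis using that[of c] by (auto simp: mult_less_0_iff)
  qed
  obtain e1 where e1: "c1 < e1" "e1 < c2" "D3 e1 > 0"
  proof -
    obtain c where c: "c1 < c" "c < c2" "D2 c2 - D2 c1 = (c2 - c1) * D3 c"
      using MVT2[of c1 c2 D2 D3] d2 c1 c2 by force
    with c1 c2 have "0 < (c2 - c1) * D3 c" by linarith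
    with c show thesis using that[of c] by (auto simp: zero_less_mult_iff)
  qed
  obtain e2 where e2: "c2 < e2" "D3 e2 < 0"
  proof -
    obtain c where c: "c2 < c" "c < c3" "D2 c3 - D2 c2 = (c3 - c2) * D3 c"
      using MVT2[of c2 c3 D2 D3] d2 c2 c3 by force
    with c2 c3 have "0 > (c3 - c2) * D3 c" by linarith
    with c show thesis using that[of c] by (auto simp: mult_less_0_iff)
  qed
  \<comment> \<open>This is the convexity of \<open>D2\<close>: its derivative cannot pass from
    positive at \<open>e1\<close> to negative at \<open>e2\<close>.\<close>
  have "D3 e1 < D3 e2"
    using normal_tail_strict_antimono[of e1 e2] e1 e2 by (simp add: D3_def)
  with e1 e2 show False by simp
qed

section \<open>Comparison for one summand\<close>

lemma std_normal_distributed: "distributed std_normal_distribution lborel (\<lambda>x. x) std_normal_density"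
  unfolding distributed_def by (auto simp: distr_id2 intro!: measure_eqI)

lemma nn_integral_std_normal_scale:
  fixes F :: "real \<Rightarrow> ennreal"
  assumes [measurable]: "F \<in> borel_measurable borel" and "0 < s"
  shows "(\<integral>\<^sup>+x. F (s * x) \<partial>std_normal_distribution) = (\<integral>\<^sup>+x. F x \<partial>density lborel (normal_density 0 s))"
proof -
  have "distributed std_normal_distribution lborel (\<lambda>x. 0 + s * x) (normal_density (0 + s * 0) (\<bar>s\<bar> * 1))"
    using assms std_normal_distributed by (intro std_normal.normal_density_affine) auto
  then have "distr std_normal_distribution lborel (\<lambda>x. s * x) = density lborel (normal_density 0 s)"
    using \<open>0 < s\<close> by (simp add: distributed_distr_eq_density)
  then show ?thesis
    by (subst (asm) eq_commute) (simp add: nn_integral_distr)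
qed

text \<open>Stability of the Gaussian law under convolution. Zero scales occur for the empty sum and
  for zero coefficients; they are split off because a degenerate Gaussian has no density.\<close>

lemma nn_integral_std_normal_add:
  fixes F :: "real \<Rightarrow> ennreal"
  assumes [measurable]: "F \<in> borel_measurable borel" and "0 \<le> s" "0 \<le> r"
  shows "(\<integral>\<^sup>+x. \<integral>\<^sup>+y. F (s * x + r * y) \<partial>std_normal_distribution \<partial>std_normal_distribution)
    = (\<integral>\<^sup>+x. F (sqrt (s\<^sup>2 + r\<^sup>2) * x) \<partial>std_normal_distribution)"
proof -
  let ?N = "\<lambda>\<sigma>. density lborel (normal_density 0 \<sigma>)"
  have one: "emeasure std_normal_distribution UNIV = 1"
    using std_normal.emeasure_space_1 by simp
  consider "s = 0" | "r = 0" | "0 < s" "0 < r" using assms by linarith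
  then show ?thesis
  proof cases
    case 3
    have fin: "finite_measure (?N \<sigma>)" if "0 < \<sigma>" for \<sigma>
      using prob_space_normal_density[OF that] by (simp add: prob_space_def)
    have sq: "0 < sqrt (s\<^sup>2 + r\<^sup>2)" using 3 by (simp add: add_pos_pos)
    have "(\<integral>\<^sup>+x. \<integral>\<^sup>+y. F (s * x + r * y) \<partial>std_normal_distribution \<partial>std_normal_distribution)
        = (\<integral>\<^sup>+x. \<integral>\<^sup>+y. F (s * x + y) \<partial>?N r \<partial>std_normal_distribution)"
      using 3 by (intro nn_integral_cong nn_integral_std_normal_scale) auto
    also have "\<dots> = (\<integral>\<^sup>+x. \<integral>\<^sup>+y. F (x + y) \<partial>?N r \<partial>?N s)"
    proof (rule nn_integral_std_normal_scale[where F = "\<lambda>x. \<integral>\<^sup>+y. F (x + y) \<partial>?N r"])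
      interpret sigma_finite_measure "?N r"
        using fin[of r] 3 by (simp add: finite_measure_def)
      show "(\<lambda>x. \<integral>\<^sup>+y. F (x + y) \<partial>?N r) \<in> borel_measurable borel"
        by measurable
    qed fact
    also have "\<dots> = (\<integral>\<^sup>+x. F x \<partial>(?N s \<star> ?N r))"
      using 3 by (intro nn_integral_convolution[symmetric] fin) auto
    also have "?N s \<star> ?N r = ?N (sqrt (s\<^sup>2 + r\<^sup>2))"
      using 3 fin by (subst convolution_density)
        (auto simp: conv_normal_density_zero_mean[symmetric] ennreal_mult')
    also have "(\<integral>\<^sup>+x. F x \<partial>\<dots>) = (\<integral>\<^sup>+x. F (sqrt (s\<^sup>2 + r\<^sup>2) * x) \<partial>std_normal_distribution)"
      using sq by (intro nn_integral_std_normal_scale[symmetric]) auto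
    finally show ?thesis .
  qed (use assms in \<open>auto simp: one\<close>)
qed

lemma nn_integral_cube_part_scaled:
  assumes "0 < s"
  shows "(\<integral>\<^sup>+x. cube_part (s * x - t) \<partial>std_normal_distribution) = ennreal (s ^ 3 * gauss_cube (t / s))"
proof -
  have "cube_part (s * x - t) = s ^ 3 * cube_part (x - t / s)" for x
  proof -
    have "s * x - t = s * (x - t / s)" using assms by (simp add: right_diff_distrib)
    then show ?thesis using assms by (simp only: cube_part_scale less_imp_le)
  qed
  then have "(\<integral>\<^sup>+x. cube_part (s * x - t) \<partial>std_normal_distribution)
      = (\<integral>\<^sup>+x. ennreal (s ^ 3) * cube_part (x - t / s) \<partial>std_normal_distribution)"
    using assms by (simp add: ennreal_mult')
  also have "\<dots> = ennreal (s ^ 3) * gauss_cube (t / s)"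
    by (subst nn_integral_cmult) (auto simp: nn_integral_cube_part_std_normal)
  finally show ?thesis using assms by (simp add: ennreal_mult')
qed

text \<open>The expectation of \<open>F (y + a * X)\<close> for a lazy sign \<open>X\<close> with
  \<open>P (X = 0) = \<rho>\<close>. As an operator on functions it lets one summand be averaged out
  at a time.\<close>

definition lazy_avg :: "real \<Rightarrow> real \<Rightarrow> (real \<Rightarrow> real) \<Rightarrow> real \<Rightarrow> real" where
  "lazy_avg \<rho> a F y = \<rho> * F y + (1 - \<rho>) / 2 * (F (y + a) + F (y - a))"

text \<open>For \<open>t \<ge> 0\<close> only the value \<open>a\<close> contributes, with weight
  \<open>\<sigma>\<^sup>2 / 2\<close> where \<open>\<sigma>\<^sup>2 = 1 - \<rho>\<close>. The
  assumption \<open>\<rho> \<le> 1 / 2\<close> says \<open>\<sigma> \<ge> 1 / sqrt 2\<close>; this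
  serves once inside the truncated cube, to reach the argument \<open>sqrt 2 - u\<close> of
  \<open>gauss_cube_ge\<close>, and once to bound the factor \<open>sqrt 2\<close> by
  \<open>2 * \<sigma>\<close>.\<close>

lemma lazy_avg_cube_part_le_of_nonneg:
  assumes \<rho>: "0 \<le> \<rho>" "\<rho> \<le> 1 / 2" and a: "0 < a" and t: "0 \<le> t"
  shows "lazy_avg \<rho> a cube_part (- t) \<le> (a * sqrt (1 - \<rho>)) ^ 3 * gauss_cube (t / (a * sqrt (1 - \<rho>)))"
proof -
  define \<sigma> where "\<sigma> = sqrt (1 - \<rho>)"
  define u where "u = t / (a * \<sigma>)"
  have \<sigma>: "0 < \<sigma>" "\<sigma>\<^sup>2 = 1 - \<rho>" "1 / sqrt 2 \<le> \<sigma>"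
    using \<rho> by (auto simp: \<sigma>_def real_sqrt_divide[symmetric] intro!: real_le_rsqrt simp: power_divide)
  have u: "0 \<le> u" "a - t = a * (1 - \<sigma> * u)" using a t \<sigma> by (auto simp: u_def right_diff_distrib)
  have "1 - \<sigma> * u \<le> 1 - 1 / sqrt 2 * u"
    using \<sigma> u mult_right_mono by (intro diff_left_mono mult_right_mono) auto
  then have "cube_part (1 - \<sigma> * u) \<le> cube_part (1 / sqrt 2 * (sqrt 2 - u))"
    by (intro cube_part_mono) (simp add: diff_divide_distrib)
  also have "\<dots> = cube_part (sqrt 2 - u) / 4 * sqrt 2"
    by (subst cube_part_scale) (auto simp: power_divide power3_eq_cube field_simps)
  also have "\<dots> \<le> gauss_cube u * (2 * \<sigma>)"
  proof (intro mult_mono gauss_cube_ge gauss_cube_nonneg u)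
    have "sqrt 2 = 2 * (1 / sqrt 2)" by (simp add: field_simps)
    also have "\<dots> \<le> 2 * \<sigma>" using \<sigma> by (intro mult_left_mono) auto
    finally show "sqrt 2 \<le> 2 * \<sigma>" .
  qed auto
  finally have main: "\<sigma>\<^sup>2 / 2 * cube_part (1 - \<sigma> * u) \<le> \<sigma>\<^sup>2 / 2 * (gauss_cube u * (2 * \<sigma>))"
    by (intro mult_left_mono) auto
  have "cube_part (- t) = 0" "cube_part (- t - a) = 0"
    using a t by (auto simp: cube_part_def)
  then have "lazy_avg \<rho> a cube_part (- t) = a ^ 3 * (\<sigma>\<^sup>2 / 2 * cube_part (1 - \<sigma> * u))"
    using u(2) a by (simp add: lazy_avg_def cube_part_scale \<sigma>(2))
  also have "\<dots> \<le> a ^ 3 * (\<sigma>\<^sup>2 / 2 * (gauss_cube u * (2 * \<sigma>)))"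
    using main a by (intro mult_left_mono[OF main]) auto
  also have "\<dots> = (a * \<sigma>) ^ 3 * gauss_cube u"
    by (simp add: power_mult_distrib power3_eq_cube power2_eq_square)
  finally show ?thesis by (simp add: u_def \<sigma>_def)
qed

text \<open>Every real \<open>t\<close> is covered because later \<open>t\<close> is shifted by the
  value of the other summands. The left-hand side is even in \<open>a\<close>, and for
  \<open>a = 0\<close> both sides are \<open>cube_part (- t)\<close>.\<close>

lemma lazy_avg_cube_part_le:
  assumes \<rho>: "0 \<le> \<rho>" "\<rho> \<le> 1 / 2"
  shows "ennreal (lazy_avg \<rho> a cube_part (- t))
    \<le> (\<integral>\<^sup>+x. cube_part (\<bar>a\<bar> * sqrt (1 - \<rho>) * x - t) \<partial>std_normal_distribution)"
proof (cases "a = 0")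
  case True
  then show ?thesis
    using std_normal.emeasure_space_1 by (simp add: lazy_avg_def field_simps)
next
  case False
  define b where "b = \<bar>a\<bar>"
  define s where "s = b * sqrt (1 - \<rho>)"
  have b: "0 < b" and s: "0 < s" "s\<^sup>2 = b\<^sup>2 * (1 - \<rho>)"
    using False \<rho> by (auto simp: b_def s_def power_mult_distrib)
  have "lazy_avg \<rho> a F y = lazy_avg \<rho> b F y" for F y
    by (auto simp: lazy_avg_def b_def abs_if add.commute)
  then have "lazy_avg \<rho> a cube_part (- t) = lazy_avg \<rho> b cube_part (- t)" .
  also have "\<dots> \<le> s ^ 3 * gauss_cube (t / s)"
  proof (cases "0 \<le> t")
    case True
    then show ?thesis
      using lazy_avg_cube_part_le_of_nonneg[OF \<rho> b True] by (simp add: s_def)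
  next
    case False
    \<comment> \<open>The two laws have the same moments up to order 3, so both sides change by the same
      polynomial under \<open>t \<mapsto> - t\<close>.\<close>
    have "lazy_avg \<rho> b cube_part (- t) = lazy_avg \<rho> b cube_part t - t ^ 3 - 3 * t * s\<^sup>2"
    proof -
      have e: "cube_part (- t + b) = cube_part (t - b) - (t - b) ^ 3"
        "cube_part (- t - b) = cube_part (t + b) - (t + b) ^ 3"
        using cube_part_minus[of "t - b"] cube_part_minus[of "t + b"] by simp_all
      show ?thesis
        unfolding lazy_avg_def s(2) e cube_part_minus[of t]
        by (simp add: field_simps power2_eq_square power3_eq_cube)
    qed
    also have "\<dots> \<le> s ^ 3 * gauss_cube (- t / s) - t ^ 3 - 3 * t * s\<^sup>2"
      using lazy_avg_cube_part_le_of_nonneg[OF \<rho> b, of "- t"] False by (simp add: s_def)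
    also have "\<dots> = s ^ 3 * gauss_cube (t / s)"
      using s(1) by (simp add: gauss_cube_minus field_simps power2_eq_square power3_eq_cube)
    finally show ?thesis .
  qed
  finally show ?thesis
    using s(1) by (simp add: nn_integral_cube_part_scaled ennreal_leI flip: b_def s_def)
qed

section \<open>Powers as mixtures of truncated cubes\<close>

lemma nn_integral_cube_part_powr:
  assumes "3 < p" "0 \<le> y"
  shows "(\<integral>\<^sup>+t\<in>{0..}. ennreal (t powr (p - 4) * cube_part (y - t)) \<partial>lborel) = ennreal (Beta (p - 3) 4 * y powr p)"
proof (cases "y = 0")
  case True
  then show ?thesis by (auto simp: cube_part_def intro!: nn_integral_0_iff_AE[THEN iffD2] split: split_indicator)
next
  case False
  with assms have y: "0 < y" by simp
  \<comment> \<open>Substituting \<open>y * t\<close> for \<open>t\<close> takes out the factor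
    \<open>y * (y powr (p - 4) * y ^ 3) = y powr p\<close> and leaves the Beta integral on
    \<open>[0, 1]\<close>, which converges because \<open>p - 3 > 0\<close>.\<close>
  have "(\<integral>\<^sup>+t\<in>{0..}. ennreal (t powr (p - 4) * cube_part (y - t)) \<partial>lborel)
      = \<bar>y\<bar> * (\<integral>\<^sup>+t. ennreal ((0 + y * t) powr (p - 4) * cube_part (y - (0 + y * t))) * indicator {0..} (0 + y * t) \<partial>lborel)"
    using y by (intro nn_integral_real_affine) auto
  also have "\<dots> = \<bar>y\<bar> * (\<integral>\<^sup>+t. ennreal (y powr (p - 4) * y ^ 3) *
      (ennreal (t powr (p - 3 - 1) * (1 - t) powr (4 - 1)) * indicator {0..1} t) \<partial>lborel)"
  proof (rule arg_cong[where f = "\<lambda>I. ennreal \<bar>y\<bar> * I"], rule nn_integral_cong)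
    fix t :: real
    have "cube_part (y - y * t) = y ^ 3 * cube_part (1 - t)"
      using y cube_part_scale[of y "1 - t"] by (simp add: algebra_simps)
    moreover have "cube_part (1 - t) = (1 - t) powr 3" if "t \<le> 1"
      using that by (cases "t = 1") (auto simp: cube_part_def powr_numeral)
    moreover have "cube_part (1 - t) = 0" if "\<not> t \<le> 1"
      using that by (simp add: cube_part_def)
    ultimately show "ennreal ((0 + y * t) powr (p - 4) * cube_part (y - (0 + y * t))) * indicator {0..} (0 + y * t)
      = ennreal (y powr (p - 4) * y ^ 3) * (ennreal (t powr (p - 3 - 1) * (1 - t) powr (4 - 1)) * indicator {0..1} t)"
      using y by (auto simp: powr_mult zero_le_mult_iff ennreal_mult'[symmetric] mult_ac split: split_indicator)
  qed
  also have "\<dots> = \<bar>y\<bar> * (ennreal (y powr (p - 4) * y ^ 3) * Beta (p - 3) 4)"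
    using assms has_integral_Beta_real[of "p - 3" 4]
    by (subst nn_integral_cmult, measurable, subst nn_integral_has_integral_lebesgue') auto
  also have "\<dots> = ennreal (y * (y powr (p - 4) * y ^ 3) * Beta (p - 3) 4)"
    using y by (simp add: ennreal_mult' mult.assoc)
  also have "y * (y powr (p - 4) * y ^ 3) = y powr p"
  proof -
    have "y powr p = y powr (p - 4) * y powr 4" by (simp flip: powr_add)
    then show ?thesis using y by (simp add: powr_numeral power_numeral_reduce mult_ac)
  qed
  finally show ?thesis by (simp add: mult.commute)
qed

text \<open>For \<open>t \<ge> 0\<close> at most one of the two truncated cubes is nonzero, and
  their sum depends on \<open>\<bar>y\<bar>\<close> alone.\<close>

lemma nn_integral_cube_part_powr_abs:
  assumes "3 < p"
  shows "(\<integral>\<^sup>+t\<in>{0..}. ennreal (t powr (p - 4)) * (ennreal (cube_part (y - t)) + ennreal (cube_part (- y - t))) \<partial>lborel)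
    = ennreal (Beta (p - 3) 4) * ennreal (\<bar>y\<bar> powr p)"
proof -
  have "(\<integral>\<^sup>+t\<in>{0..}. ennreal (t powr (p - 4)) * (ennreal (cube_part (y - t)) + ennreal (cube_part (- y - t))) \<partial>lborel)
      = (\<integral>\<^sup>+t\<in>{0..}. ennreal (t powr (p - 4) * cube_part (\<bar>y\<bar> - t)) \<partial>lborel)"
  proof (rule nn_integral_cong)
    fix t :: real
    have "cube_part (y - t) + cube_part (- y - t) = cube_part (\<bar>y\<bar> - t)" if "0 \<le> t"
      using that by (cases "0 \<le> y") (auto simp: cube_part_def)
    then show "ennreal (t powr (p - 4)) * (ennreal (cube_part (y - t)) + ennreal (cube_part (- y - t)))
        * indicator {0..} t = ennreal (t powr (p - 4) * cube_part (\<bar>y\<bar> - t)) * indicator {0..} t"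
      by (auto simp: ennreal_mult' simp flip: ennreal_plus split: split_indicator)
  qed
  also have "\<dots> = ennreal (Beta (p - 3) 4 * \<bar>y\<bar> powr p)"
    using assms by (rule nn_integral_cube_part_powr) simp
  finally show ?thesis by (simp add: ennreal_mult'')
qed

lemma integrable_std_normal_abs_powr:
  assumes "0 \<le> p"
  shows "integrable std_normal_distribution (\<lambda>x. \<bar>x\<bar> powr p)"
proof -
  \<comment> \<open>A natural exponent \<open>k \<ge> p\<close> gives the dominating function
    \<open>1 + \<bar>x\<bar> ^ k\<close>, whose Gaussian integral is finite.\<close>
  obtain k :: nat where k: "p \<le> real k" using real_arch_simple by blast
  have "integrable std_normal_distribution (\<lambda>x. 1 + \<bar>x\<bar> ^ k)"
    by (subst integrable_density)
       (auto simp: distrib_left intro!: Bochner_Integration.integrable_add integrable_std_normal_moment_abs)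
  then show ?thesis
  proof (rule Bochner_Integration.integrable_bound)
    have "\<bar>x\<bar> powr p \<le> 1 + \<bar>x\<bar> ^ k" for x :: real
    proof (cases "\<bar>x\<bar> \<le> 1")
      case True
      then have "\<bar>x\<bar> powr p \<le> 1" using assms by (simp add: powr_le1)
      then show ?thesis by (smt (verit) zero_le_power abs_ge_zero)
    next
      case False
      then have "\<bar>x\<bar> powr p \<le> \<bar>x\<bar> powr k" using k by (intro powr_mono) auto
      then show ?thesis using False by (simp add: powr_realpow)
    qed
    then show "AE x in std_normal_distribution. norm (\<bar>x\<bar> powr p) \<le> norm (1 + \<bar>x\<bar> ^ k)"
      by (intro AE_I2) (smt (verit) powr_ge_zero real_norm_def)
  qed simp
qed

section \<open>Weighted sums of lazy random signs\<close>

text \<open>For \<open>p > 3\<close> both hypotheses are integrated over \<open>t \<ge> 0\<close>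
  with weight \<open>t powr (p - 4)\<close>; after exchanging the integrals, the mixture formula
  turns each side into the same constant times an absolute moment of order \<open>p\<close>.\<close>

lemma nn_integral_abs_powr_le_of_cube_part:
  assumes "prob_space M" "prob_space N" "3 \<le> p"
    and [measurable]: "Y \<in> borel_measurable M" "Z \<in> borel_measurable N"
    and le: "\<And>t. 0 \<le> t \<Longrightarrow> (\<integral>\<^sup>+x. cube_part (Y x - t) \<partial>M) \<le> (\<integral>\<^sup>+x. cube_part (Z x - t) \<partial>N)"
      "\<And>t. 0 \<le> t \<Longrightarrow> (\<integral>\<^sup>+x. cube_part (- Y x - t) \<partial>M) \<le> (\<integral>\<^sup>+x. cube_part (- Z x - t) \<partial>N)"
  shows "(\<integral>\<^sup>+x. \<bar>Y x\<bar> powr p \<partial>M) \<le> (\<integral>\<^sup>+x. \<bar>Z x\<bar> powr p \<partial>N)"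
proof (cases "p = 3")
  case True
  \<comment> \<open>At \<open>p = 3\<close> the weight is not integrable near 0; instead the
    absolute cube is the sum of the two truncated cubes at \<open>t = 0\<close>.\<close>
  have *: "ennreal (\<bar>y\<bar> powr 3) = ennreal (cube_part (y - 0)) + ennreal (cube_part (- y - 0))" for y
    by (auto simp: cube_part_def max_def abs_if powr_numeral simp flip: ennreal_plus)
  show ?thesis
    unfolding True * by (subst (1 2) nn_integral_add) (auto intro!: add_mono le[of 0, simplified])
next
  case False
  with assms have p: "3 < p" by simp
  define K where "K = ennreal (Beta (p - 3) 4)"
  \<comment> \<open>The constant \<open>K\<close> is neither 0 nor infinite, so it can be cancelled
    in \<open>ennreal\<close> at the end.\<close>
  have "Beta (p - 3) 4 > 0" using p by (auto simp: Beta_def)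
  then have K: "K \<noteq> 0" "K \<noteq> \<top>" by (auto simp: K_def)
  define w :: "real \<Rightarrow> ennreal" where "w t = ennreal (t powr (p - 4)) * indicator {0..} t" for t
  have [measurable]: "w \<in> borel_measurable borel" unfolding w_def[abs_def] by measurable
  have eq: "K * (\<integral>\<^sup>+x. \<bar>V x\<bar> powr p \<partial>Q) =
      (\<integral>\<^sup>+t. w t * ((\<integral>\<^sup>+x. cube_part (V x - t) \<partial>Q) + (\<integral>\<^sup>+x. cube_part (- V x - t) \<partial>Q)) \<partial>lborel)"
    if "prob_space Q" and [measurable]: "V \<in> borel_measurable Q" for Q :: "'c measure" and V
  proof -
    interpret Q: prob_space Q by fact
    interpret pair_sigma_finite lborel Q ..
    have "K * (\<integral>\<^sup>+x. \<bar>V x\<bar> powr p \<partial>Q) = (\<integral>\<^sup>+x. K * \<bar>V x\<bar> powr p \<partial>Q)"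
      by (simp add: nn_integral_cmult)
    also have "\<dots> = (\<integral>\<^sup>+x. \<integral>\<^sup>+t. w t * (cube_part (V x - t) + cube_part (- V x - t)) \<partial>lborel \<partial>Q)"
      unfolding K_def nn_integral_cube_part_powr_abs[OF p, symmetric]
      by (intro nn_integral_cong) (simp add: w_def mult_ac)
    also have "\<dots> = (\<integral>\<^sup>+t. \<integral>\<^sup>+x. w t * (cube_part (V x - t) + cube_part (- V x - t)) \<partial>Q \<partial>lborel)"
      by (intro Fubini') measurable
    also have "\<dots> = (\<integral>\<^sup>+t. w t * ((\<integral>\<^sup>+x. cube_part (V x - t) \<partial>Q) + (\<integral>\<^sup>+x. cube_part (- V x - t) \<partial>Q)) \<partial>lborel)"
      by (simp add: nn_integral_cmult nn_integral_add)
    finally show ?thesis .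
  qed
  have "K * (\<integral>\<^sup>+x. \<bar>Y x\<bar> powr p \<partial>M) \<le> K * (\<integral>\<^sup>+x. \<bar>Z x\<bar> powr p \<partial>N)"
    unfolding eq[OF \<open>prob_space M\<close> assms(4)] eq[OF \<open>prob_space N\<close> assms(5)]
    by (intro nn_integral_mono) (auto simp: w_def intro!: mult_left_mono add_mono le split: split_indicator)
  then show ?thesis
    using K by (simp add: ennreal_mult_le_mult_iff)
qed

text \<open>Serves to pass from a family indexed by \<open>{1..}\<close> to one indexed from 0, the
  form in which the central limit theorem is applied.\<close>

lemma (in prob_space) indep_vars_reindex:
  assumes "inj_on f I" and indep: "indep_vars M' X (f ` I)"
  shows "indep_vars (\<lambda>i. M' (f i)) (\<lambda>i. X (f i)) I"
  unfolding indep_vars_def2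
proof (intro conjI ballI indep_setsI)
  from indep have rv: "random_variable (M' (f i)) (X (f i))" if "i \<in> I" for i
    using that by (auto simp: indep_vars_def2)
  then show "random_variable (M' (f i)) (X (f i))" if "i \<in> I" for i using that .
  show "{X (f i) -` A \<inter> space M |A. A \<in> sets (M' (f i))} \<subseteq> events" if "i \<in> I" for i
    using rv[OF that] by (auto intro: measurable_sets)
  fix A J
  assume J: "J \<noteq> {}" "J \<subseteq> I" "finite J"
    and A: "\<forall>j\<in>J. A j \<in> {X (f j) -` A \<inter> space M |A. A \<in> sets (M' (f j))}"
  have inv: "inv_into I f (f j) = j" if "j \<in> J" for j
    using that J assms(1) by (auto intro: inv_into_f_f)
  \<comment> \<open>The events are carried over to the image of \<open>J\<close> by
    \<open>inv_into\<close>, which undoes \<open>f\<close> by injectivity; there the independence of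
    \<open>X\<close> gives the product formula.\<close>
  have "prob (\<Inter>j\<in>f ` J. A (inv_into I f j)) = (\<Prod>j\<in>f ` J. prob (A (inv_into I f j)))"
    using J A inv indep unfolding indep_vars_def2
    by (intro indep_setsD[of "\<lambda>i. {X i -` A \<inter> space M |A. A \<in> sets (M' i)}" "f ` I"]) auto
  also have "\<dots> = (\<Prod>j\<in>J. prob (A j))"
    using inv inj_on_subset[OF assms(1) J(2)] by (simp add: prod.reindex)
  finally show "prob (\<Inter>j\<in>J. A j) = (\<Prod>j\<in>J. prob (A j))"
    using inv by simp
qed

lemma ennreal_lazy_avg:
  assumes "\<And>y. 0 \<le> F y" "0 \<le> \<rho>" "\<rho> \<le> 1"
  shows "ennreal (lazy_avg \<rho> a F y) = ennreal \<rho> * F y + ennreal ((1 - \<rho>) / 2) * (ennreal (F (y + a)) + F (y - a))"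
proof -
  have "ennreal (lazy_avg \<rho> a F y) = ennreal (\<rho> * F y) + ennreal ((1 - \<rho>) / 2 * (F (y + a) + F (y - a)))"
    using assms unfolding lazy_avg_def by (intro ennreal_plus) auto
  also have "\<dots> = ennreal \<rho> * F y + ennreal ((1 - \<rho>) / 2) * (ennreal (F (y + a) + F (y - a)))"
    using assms by (simp only: ennreal_mult' divide_nonneg_pos diff_ge_0_iff_ge zero_less_numeral)
  finally show ?thesis using assms by simp
qed

lemma nn_integral_lazy_avg:
  assumes [measurable]: "F \<in> borel_measurable borel" "g \<in> borel_measurable M"
    and "\<And>y. 0 \<le> F y" "0 \<le> \<rho>" "\<rho> \<le> 1"
  shows "(\<integral>\<^sup>+x. lazy_avg \<rho> a F (g x) \<partial>M) = ennreal \<rho> * (\<integral>\<^sup>+x. F (g x) \<partial>M)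
    + ennreal ((1 - \<rho>) / 2) * ((\<integral>\<^sup>+x. F (g x + a) \<partial>M) + (\<integral>\<^sup>+x. F (g x - a) \<partial>M))"
  using assms by (simp add: ennreal_lazy_avg nn_integral_add nn_integral_cmult)

locale lazy_signs = prob_space +
  fixes X :: "nat \<Rightarrow> 'a \<Rightarrow> real" and \<rho> :: real
  assumes \<rho>: "0 \<le> \<rho>" "\<rho> \<le> 1 / 2"
    and indep: "indep_vars (\<lambda>_. borel) X {1..}"
    and prob_0: "\<And>i. 1 \<le> i \<Longrightarrow> prob {\<omega> \<in> space M. X i \<omega> = 0} = \<rho>"
    and prob_1: "\<And>i. 1 \<le> i \<Longrightarrow> prob {\<omega> \<in> space M. X i \<omega> = 1} = (1 - \<rho>) / 2"
    and prob_m1: "\<And>i. 1 \<le> i \<Longrightarrow> prob {\<omega> \<in> space M. X i \<omega> = -1} = (1 - \<rho>) / 2"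
begin

lemma X_measurable: "1 \<le> i \<Longrightarrow> random_variable borel (X i)"
  using indep by (auto simp: indep_vars_def2)

text \<open>The three given probabilities add up to 1, so other values have probability 0.\<close>

lemma AE_X:
  assumes "1 \<le> i"
  shows "AE \<omega> in M. X i \<omega> = 0 \<or> X i \<omega> = 1 \<or> X i \<omega> = -1"
proof -
  note [measurable] = X_measurable[OF assms]
  let ?A = "\<lambda>c. {\<omega> \<in> space M. X i \<omega> = c}"
  have "prob (?A 1 \<union> ?A (-1)) = prob (?A 1) + prob (?A (-1))"
    by (rule finite_measure_Union) auto
  moreover have "prob (?A 0 \<union> (?A 1 \<union> ?A (-1))) = prob (?A 0) + prob (?A 1 \<union> ?A (-1))"
    by (rule finite_measure_Union) auto
  ultimately have "prob (?A 0 \<union> (?A 1 \<union> ?A (-1))) = 1"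
    using assms by (simp add: prob_0 prob_1 prob_m1)
  from AE_prob_1[OF this] show ?thesis
    by eventually_elim auto
qed

lemma nn_integral_X:
  fixes F :: "real \<Rightarrow> ennreal"
  assumes "1 \<le> i"
  shows "(\<integral>\<^sup>+\<omega>. F (X i \<omega>) \<partial>M) = ennreal \<rho> * F 0 + ennreal ((1 - \<rho>) / 2) * (F 1 + F (-1))"
proof -
  note [measurable] = X_measurable[OF assms]
  let ?A = "\<lambda>c. {\<omega> \<in> space M. X i \<omega> = c}"
  have "(\<integral>\<^sup>+\<omega>. F (X i \<omega>) \<partial>M) = (\<integral>\<^sup>+\<omega>. F 0 * indicator (?A 0) \<omega> + F 1 * indicator (?A 1) \<omega>
      + F (-1) * indicator (?A (-1)) \<omega> \<partial>M)"
  proof (rule nn_integral_cong_AE)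
    show "AE \<omega> in M. F (X i \<omega>) = F 0 * indicator (?A 0) \<omega> + F 1 * indicator (?A 1) \<omega>
        + F (-1) * indicator (?A (-1)) \<omega>"
      using AE_X[OF assms] AE_space by eventually_elim (auto simp: indicator_def)
  qed
  also have "\<dots> = F 0 * emeasure M (?A 0) + F 1 * emeasure M (?A 1) + F (-1) * emeasure M (?A (-1))"
    by (simp add: nn_integral_add nn_integral_cmult)
  finally show ?thesis
    using assms by (simp add: emeasure_eq_measure prob_0 prob_1 prob_m1 algebra_simps)
qed

text \<open>The integral of an indicator of \<open>X k\<close> is the same expression for every
  \<open>k\<close>. The central limit theorem needs this common law.\<close>

lemma distr_X: "1 \<le> i \<Longrightarrow> 1 \<le> j \<Longrightarrow> distr M borel (X i) = distr M borel (X j)"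
proof (rule measure_eqI)
  fix A assume ij: "1 \<le> i" "1 \<le> j" and "A \<in> sets (distr M borel (X i))"
  then have [measurable]: "A \<in> sets borel" by simp
  have "emeasure (distr M borel (X k)) A = (\<integral>\<^sup>+\<omega>. indicator A (X k \<omega>) \<partial>M)" if "1 \<le> k" for k
    using X_measurable[OF that] nn_integral_distr[of "X k" M borel "indicator A"] by simp
  then show "emeasure (distr M borel (X i)) A = emeasure (distr M borel (X j)) A"
    using ij by (simp add: nn_integral_X)
qed simp

lemma expectation_X:
  assumes "1 \<le> i"
  shows "expectation (X i) = 0"
    and "integrable M (\<lambda>\<omega>. (X i \<omega>)\<^sup>2)" "expectation (\<lambda>\<omega>. (X i \<omega>)\<^sup>2) = 1 - \<rho>"
proof -
  note [measurable] = X_measurable[OF assms]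
  let ?A = "\<lambda>c. {\<omega> \<in> space M. X i \<omega> = c}"
  \<comment> \<open>With \<open>F 0 = 0\<close> the atom at 0 drops out. The mean and the second
    moment are the instances of \<open>F\<close> as identity and as square.\<close>
  have *: "has_bochner_integral M (\<lambda>\<omega>. F (X i \<omega>)) (prob (?A 1) * F 1 + prob (?A (-1)) * F (-1))"
    if [measurable]: "F \<in> borel_measurable borel" and "F 0 = 0" for F :: "real \<Rightarrow> real"
  proof -
    have "has_bochner_integral M (\<lambda>\<omega>. indicator (?A 1) \<omega> * F 1 + indicator (?A (-1)) \<omega> * F (-1))
        (prob (?A 1) * F 1 + prob (?A (-1)) * F (-1))"
      by (intro has_bochner_integral_add has_bochner_integral_mult_left has_bochner_integral_real_indicator)
         (auto simp: emeasure_eq_measure)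
    moreover have "AE \<omega> in M. indicator (?A 1) \<omega> * F 1 + indicator (?A (-1)) \<omega> * F (-1) = F (X i \<omega>)"
      using AE_X[OF assms] AE_space by eventually_elim (auto simp: indicator_def \<open>F 0 = 0\<close>)
    ultimately show ?thesis
      by (subst (asm) has_bochner_integral_cong_AE) auto
  qed
  from *[of "\<lambda>x. x"] *[of "\<lambda>x. x\<^sup>2"] assms
  show "expectation (X i) = 0"
    and "integrable M (\<lambda>\<omega>. (X i \<omega>)\<^sup>2)" "expectation (\<lambda>\<omega>. (X i \<omega>)\<^sup>2) = 1 - \<rho>"
    by (auto simp: has_bochner_integral_iff prob_1 prob_m1)
qed

text \<open>By independence the joint law is a product; integrating out \<open>X i\<close> first
  leaves the three-point average.\<close>

lemma nn_integral_add_X: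
  assumes i: "1 \<le> i" and ind: "indep_var borel (\<lambda>\<omega>. a * X i \<omega>) borel S"
    and [measurable]: "F \<in> borel_measurable borel" and F: "\<And>y. 0 \<le> F y"
  shows "(\<integral>\<^sup>+\<omega>. F (S \<omega> + a * X i \<omega>) \<partial>M) = (\<integral>\<^sup>+\<omega>. lazy_avg \<rho> a F (S \<omega>) \<partial>M)"
proof -
  let ?Y = "\<lambda>\<omega>. a * X i \<omega>"
  note [measurable] = X_measurable[OF i]
  have S[measurable]: "random_variable borel S"
    using ind by (rule indep_var_rv2)
  interpret Y: prob_space "distr M borel ?Y" by (rule prob_space_distr) simp
  interpret S: prob_space "distr M borel S" by (rule prob_space_distr) simp
  interpret pair_sigma_finite "distr M borel ?Y" "distr M borel S" ..
  have "(\<integral>\<^sup>+\<omega>. F (S \<omega> + ?Y \<omega>) \<partial>M) = (\<integral>\<^sup>+z. F (snd z + fst z) \<partial>(distr M borel ?Y \<Otimes>\<^sub>M distr M borel S))"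
    using ind by (subst indep_var_distribution_eq[THEN iffD1, THEN conjunct2, THEN conjunct2])
      (auto simp: nn_integral_distr)
  also have "\<dots> = (\<integral>\<^sup>+s. \<integral>\<^sup>+y. F (s + y) \<partial>distr M borel ?Y \<partial>distr M borel S)"
    by (subst nn_integral_snd[symmetric]) (auto simp: case_prod_unfold)
  also have "\<dots> = (\<integral>\<^sup>+s. lazy_avg \<rho> a F s \<partial>distr M borel S)"
    using F \<rho> by (intro nn_integral_cong)
      (simp add: nn_integral_distr nn_integral_X[OF i, of "\<lambda>x. ennreal (F (_ + a * x))"] ennreal_lazy_avg)
  also have "\<dots> = (\<integral>\<^sup>+\<omega>. lazy_avg \<rho> a F (S \<omega>) \<partial>M)"
    unfolding lazy_avg_def[abs_def] by (simp add: nn_integral_distr)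
  finally show ?thesis .
qed

definition S :: "nat \<Rightarrow> (nat \<Rightarrow> real) \<Rightarrow> 'a \<Rightarrow> real" where
  "S n a \<omega> = (\<Sum>i=1..n. a i * X i \<omega>)"

text \<open>The standard deviation of \<open>S n a\<close>, equal to
  \<open>N_norm M X 2 n a\<close>, and the scale of the comparison Gaussian.\<close>

definition sd :: "nat \<Rightarrow> (nat \<Rightarrow> real) \<Rightarrow> real" where
  "sd n a = sqrt ((1 - \<rho>) * (\<Sum>i=1..n. (a i)\<^sup>2))"

lemma sd_nonneg: "0 \<le> sd n a" and sd_power2: "(sd n a)\<^sup>2 = (1 - \<rho>) * (\<Sum>i=1..n. (a i)\<^sup>2)"
  using \<rho> by (auto simp: sd_def sum_nonneg)

lemma S_measurable [measurable]: "random_variable borel (S n a)"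
  unfolding S_def[abs_def] by (intro borel_measurable_sum borel_measurable_times X_measurable) auto

lemma nn_integral_S_Suc:
  assumes "F \<in> borel_measurable borel" "\<And>y. 0 \<le> F y"
  shows "(\<integral>\<^sup>+\<omega>. F (S (Suc n) a \<omega>) \<partial>M) = (\<integral>\<^sup>+\<omega>. lazy_avg \<rho> (a (Suc n)) F (S n a \<omega>) \<partial>M)"
proof -
  have "indep_vars (\<lambda>_. borel) (\<lambda>i \<omega>. a i * X i \<omega>) (insert (Suc n) {1..n})"
    by (rule indep_vars_subset[OF indep_vars_compose2[OF indep]]) auto
  then have "indep_var borel (\<lambda>\<omega>. a (Suc n) * X (Suc n) \<omega>) borel (S n a)"
    unfolding S_def[abs_def] by (intro indep_vars_sum) auto
  from nn_integral_add_X[OF _ this] assms show ?thesis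
    by (simp add: S_def)
qed

lemma nn_integral_S_power2: "(\<integral>\<^sup>+\<omega>. (S n a \<omega>)\<^sup>2 \<partial>M) = ennreal ((sd n a)\<^sup>2)"
proof (induction n)
  case 0
  then show ?case by (simp add: S_def sd_def)
next
  case (Suc n)
  \<comment> \<open>The mixed terms cancel, so averaging out one summand adds exactly its
    variance.\<close>
  have "lazy_avg \<rho> b (\<lambda>y. y\<^sup>2) y = y\<^sup>2 + (1 - \<rho>) * b\<^sup>2" for b y :: real
    by (simp add: lazy_avg_def power2_eq_square field_simps)
  then have "(\<integral>\<^sup>+\<omega>. (S (Suc n) a \<omega>)\<^sup>2 \<partial>M) = (\<integral>\<^sup>+\<omega>. ennreal ((S n a \<omega>)\<^sup>2) + ennreal ((1 - \<rho>) * (a (Suc n))\<^sup>2) \<partial>M)"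
    using \<rho> by (subst nn_integral_S_Suc) auto
  also have "\<dots> = ennreal ((sd n a)\<^sup>2) + ennreal ((1 - \<rho>) * (a (Suc n))\<^sup>2)"
    using Suc by (subst nn_integral_add) (auto simp: emeasure_space_1)
  also have "\<dots> = ennreal ((sd (Suc n) a)\<^sup>2)"
    using \<rho> by (simp add: sd_power2 distrib_left sum_nonneg flip: ennreal_plus)
  finally show ?case .
qed

text \<open>Lindeberg's replacement as an induction: average out the last sign, replace the first
  \<open>n\<close> summands by a Gaussian, then the last sign by an independent Gaussian, and merge
  the two Gaussians.\<close>

lemma nn_integral_S_cube_part_le:
  "(\<integral>\<^sup>+\<omega>. cube_part (S n a \<omega> - t) \<partial>M) \<le> (\<integral>\<^sup>+x. cube_part (sd n a * x - t) \<partial>std_normal_distribution)"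
proof (induction n arbitrary: t)
  case 0
  have "emeasure std_normal_distribution UNIV = 1"
    using std_normal.emeasure_space_1 by simp
  then show ?case by (simp add: S_def sd_def emeasure_space_1)
next
  case (Suc n)
  define b where "b = a (Suc n)"
  have "(\<integral>\<^sup>+\<omega>. cube_part (S (Suc n) a \<omega> - t) \<partial>M) = (\<integral>\<^sup>+\<omega>. lazy_avg \<rho> b (\<lambda>y. cube_part (y - t)) (S n a \<omega>) \<partial>M)"
    unfolding b_def by (rule nn_integral_S_Suc) auto
  also have "\<dots> = ennreal \<rho> * (\<integral>\<^sup>+\<omega>. cube_part (S n a \<omega> - t) \<partial>M) + ennreal ((1 - \<rho>) / 2) *
      ((\<integral>\<^sup>+\<omega>. cube_part (S n a \<omega> - (t - b)) \<partial>M) + (\<integral>\<^sup>+\<omega>. cube_part (S n a \<omega> - (t + b)) \<partial>M))"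
    using \<rho> by (subst nn_integral_lazy_avg) (auto simp: algebra_simps)
  \<comment> \<open>The induction hypothesis is applied at the shifts \<open>t\<close>,
    \<open>t - b\<close> and \<open>t + b\<close>, which is why the induction keeps \<open>t\<close>
    arbitrary.\<close>
  also have "\<dots> \<le> ennreal \<rho> * (\<integral>\<^sup>+x. cube_part (sd n a * x - t) \<partial>std_normal_distribution) + ennreal ((1 - \<rho>) / 2) *
      ((\<integral>\<^sup>+x. cube_part (sd n a * x - (t - b)) \<partial>std_normal_distribution)
        + (\<integral>\<^sup>+x. cube_part (sd n a * x - (t + b)) \<partial>std_normal_distribution))"
    by (intro add_mono mult_left_mono Suc) auto
  also have "\<dots> = (\<integral>\<^sup>+x. lazy_avg \<rho> b (\<lambda>y. cube_part (y - t)) (sd n a * x) \<partial>std_normal_distribution)"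
    using \<rho> by (subst nn_integral_lazy_avg) (auto simp: algebra_simps)
  also have "\<dots> \<le> (\<integral>\<^sup>+x. \<integral>\<^sup>+y. cube_part (sd n a * x + \<bar>b\<bar> * sqrt (1 - \<rho>) * y - t)
      \<partial>std_normal_distribution \<partial>std_normal_distribution)"
  proof (rule nn_integral_mono)
    fix x
    have "lazy_avg \<rho> b (\<lambda>y. cube_part (y - t)) (sd n a * x) = lazy_avg \<rho> b cube_part (- (t - sd n a * x))"
      by (simp add: lazy_avg_def algebra_simps)
    then show "ennreal (lazy_avg \<rho> b (\<lambda>y. cube_part (y - t)) (sd n a * x))
        \<le> (\<integral>\<^sup>+y. cube_part (sd n a * x + \<bar>b\<bar> * sqrt (1 - \<rho>) * y - t) \<partial>std_normal_distribution)"
      using lazy_avg_cube_part_le[OF \<rho>, of b "t - sd n a * x"] by (simp add: algebra_simps)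
  qed
  also have "\<dots> = (\<integral>\<^sup>+x. cube_part (sqrt ((sd n a)\<^sup>2 + (\<bar>b\<bar> * sqrt (1 - \<rho>))\<^sup>2) * x - t) \<partial>std_normal_distribution)"
    using \<rho> by (intro nn_integral_std_normal_add[where F = "\<lambda>x. ennreal (cube_part (x - t))"])
      (auto simp: sd_nonneg)
  also have "sqrt ((sd n a)\<^sup>2 + (\<bar>b\<bar> * sqrt (1 - \<rho>))\<^sup>2) = sd (Suc n) a"
    using \<rho> by (simp add: sd_power2 power_mult_distrib b_def) (simp add: sd_def algebra_simps)
  finally show ?case .
qed

end

lemma nn_integral_std_normal_minus:
  fixes F :: "real \<Rightarrow> ennreal"
  assumes [measurable]: "F \<in> borel_measurable borel"
  shows "(\<integral>\<^sup>+x. F (- x) \<partial>std_normal_distribution) = (\<integral>\<^sup>+x. F x \<partial>std_normal_distribution)"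
proof -
  have "(\<integral>\<^sup>+x. F x \<partial>std_normal_distribution)
      = (\<integral>\<^sup>+x. ennreal (std_normal_density (- x)) * F (- x) \<partial>lborel)"
    using nn_integral_real_affine[of "\<lambda>x. ennreal (std_normal_density x) * F x" "- 1" 0]
    by (simp add: nn_integral_density)
  then show ?thesis by (simp add: nn_integral_density std_normal_density_minus)
qed

text \<open>Weak convergence controls integrals of bounded continuous functions; truncating at
  \<open>k\<close> makes it applicable, and dominated convergence then recovers the full
  moment.\<close>

lemma expectation_min_abs_powr_tendsto:
  assumes "0 \<le> p"
  shows "(\<lambda>k. \<integral>x. min (\<bar>x\<bar> powr p) (real k) \<partial>std_normal_distribution)
    \<longlonglongrightarrow> (\<integral>x. \<bar>x\<bar> powr p \<partial>std_normal_distribution)"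
proof (rule integral_dominated_convergence[where w = "\<lambda>x. \<bar>x\<bar> powr p"])
  show "AE x in std_normal_distribution. (\<lambda>k. min (\<bar>x\<bar> powr p) (real k)) \<longlonglongrightarrow> \<bar>x\<bar> powr p"
  proof (rule AE_I2)
    fix x
    obtain k :: nat where "\<bar>x\<bar> powr p \<le> real k" using real_arch_simple by blast
    then have "\<forall>j\<ge>k. min (\<bar>x\<bar> powr p) (real j) = \<bar>x\<bar> powr p" by auto
    then show "(\<lambda>k. min (\<bar>x\<bar> powr p) (real k)) \<longlonglongrightarrow> \<bar>x\<bar> powr p"
      by (intro tendsto_eventually) (unfold eventually_sequentially, blast)
  qed
qed (use assms in \<open>auto intro: integrable_std_normal_abs_powr\<close>)

section \<open>Comparison of moments with the Gaussian law\<close>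

context lazy_signs begin

lemma nn_integral_S_powr_le:
  assumes "3 \<le> p"
  shows "(\<integral>\<^sup>+\<omega>. \<bar>S n a \<omega>\<bar> powr p \<partial>M) \<le> (\<integral>\<^sup>+x. \<bar>sd n a * x\<bar> powr p \<partial>std_normal_distribution)"
proof (rule nn_integral_abs_powr_le_of_cube_part)
  fix t :: real
  show "(\<integral>\<^sup>+\<omega>. cube_part (S n a \<omega> - t) \<partial>M) \<le> (\<integral>\<^sup>+x. cube_part (sd n a * x - t) \<partial>std_normal_distribution)"
    by (rule nn_integral_S_cube_part_le)
  \<comment> \<open>Negating the sum negates the coefficients, which leaves \<open>sd\<close>
    unchanged; the symmetry of the Gaussian law then gives the reflected inequality.\<close>
  have "(\<integral>\<^sup>+\<omega>. cube_part (- S n a \<omega> - t) \<partial>M) = (\<integral>\<^sup>+\<omega>. cube_part (S n (\<lambda>i. - a i) \<omega> - t) \<partial>M)"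
    by (simp add: S_def sum_negf)
  also have "\<dots> \<le> (\<integral>\<^sup>+x. cube_part (sd n (\<lambda>i. - a i) * x - t) \<partial>std_normal_distribution)"
    by (rule nn_integral_S_cube_part_le)
  also have "\<dots> = (\<integral>\<^sup>+x. cube_part (- (sd n a * x) - t) \<partial>std_normal_distribution)"
    using nn_integral_std_normal_minus[of "\<lambda>x. ennreal (cube_part (sd n a * x - t))"]
    by (simp add: sd_def)
  finally show "(\<integral>\<^sup>+\<omega>. cube_part (- S n a \<omega> - t) \<partial>M)
      \<le> (\<integral>\<^sup>+x. cube_part (- (sd n a * x) - t) \<partial>std_normal_distribution)" .
qed (use assms in \<open>auto intro: prob_space_axioms std_normal.prob_space_axioms\<close>)

text \<open>The bound on the nonnegative integral also yields integrability, so the Bochner integral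
  in \<open>N_norm\<close> is the true moment and not the default 0.\<close>

lemma expectation_S_powr_le:
  assumes "3 \<le> p"
  shows "integrable M (\<lambda>\<omega>. \<bar>S n a \<omega>\<bar> powr p)"
    and "expectation (\<lambda>\<omega>. \<bar>S n a \<omega>\<bar> powr p)
      \<le> sd n a powr p * (\<integral>x. \<bar>x\<bar> powr p \<partial>std_normal_distribution)"
proof -
  let ?m = "\<integral>x. \<bar>x\<bar> powr p \<partial>std_normal_distribution"
  have "(\<integral>\<^sup>+x. \<bar>sd n a * x\<bar> powr p \<partial>std_normal_distribution)
      = (\<integral>\<^sup>+x. ennreal (sd n a powr p) * ennreal (\<bar>x\<bar> powr p) \<partial>std_normal_distribution)"
    using sd_nonneg[of n a] by (simp add: abs_mult powr_mult ennreal_mult')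
  also have "\<dots> = ennreal (sd n a powr p) * (\<integral>\<^sup>+x. \<bar>x\<bar> powr p \<partial>std_normal_distribution)"
    by (rule nn_integral_cmult) simp
  also have "(\<integral>\<^sup>+x. \<bar>x\<bar> powr p \<partial>std_normal_distribution) = ennreal ?m"
    using assms by (intro nn_integral_eq_integral integrable_std_normal_abs_powr) auto
  finally have le: "(\<integral>\<^sup>+\<omega>. \<bar>S n a \<omega>\<bar> powr p \<partial>M) \<le> ennreal (sd n a powr p * ?m)"
    using nn_integral_S_powr_le[OF assms, of n a] by (simp add: ennreal_mult')
  then show int: "integrable M (\<lambda>\<omega>. \<bar>S n a \<omega>\<bar> powr p)"
    by (intro integrableI_bounded) (auto simp: le_less_trans)
  show "expectation (\<lambda>\<omega>. \<bar>S n a \<omega>\<bar> powr p) \<le> sd n a powr p * ?m"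
    using le by (subst (asm) nn_integral_eq_integral[OF int]) auto
qed

lemma N_norm_eq: "N_norm M X p n a = expectation (\<lambda>\<omega>. \<bar>S n a \<omega>\<bar> powr p) powr (1 / p)"
  by (simp add: N_norm_def lp_norm_def S_def)

lemma N_norm_2: "N_norm M X 2 n a = sd n a"
proof -
  have int: "integrable M (\<lambda>\<omega>. (S n a \<omega>)\<^sup>2)"
    by (intro integrableI_bounded) (auto simp: nn_integral_S_power2)
  have "expectation (\<lambda>\<omega>. \<bar>S n a \<omega>\<bar> powr 2) = (sd n a)\<^sup>2"
    using nn_integral_S_power2[of n a] nn_integral_eq_integral[OF int] by (simp add: powr_numeral)
  then show ?thesis
    using sd_nonneg[of n a] by (simp add: N_norm_eq powr_half_sqrt)
qed

lemma N_norm_le: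
  assumes "3 \<le> p"
  shows "N_norm M X p n a \<le> lp_norm std_normal_distribution p (\<lambda>x. x) * N_norm M X 2 n a"
proof -
  have "N_norm M X p n a \<le> (sd n a powr p * (\<integral>x. \<bar>x\<bar> powr p \<partial>std_normal_distribution)) powr (1 / p)"
    unfolding N_norm_eq using assms by (intro powr_mono2 expectation_S_powr_le) auto
  also have "\<dots> = sd n a * lp_norm std_normal_distribution p (\<lambda>x. x)"
    using assms sd_nonneg[of n a] by (simp add: lp_norm_def powr_mult powr_powr)
  finally show ?thesis by (simp add: N_norm_2 mult.commute)
qed

section \<open>Optimality by the central limit theorem\<close>

lemma weak_conv_S:
  "weak_conv_m (\<lambda>n. distr M borel (\<lambda>\<omega>. S n (\<lambda>_. 1) \<omega> / sd n (\<lambda>_. 1))) std_normal_distribution"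
proof -
  have "indep_vars (\<lambda>_. borel) (\<lambda>i. X (Suc i)) UNIV"
  proof -
    have "range Suc = {1..}" by (auto simp: image_iff Suc_le_eq gr0_conv_Suc)
    then show ?thesis
      using indep_vars_reindex[of Suc UNIV "\<lambda>_. borel" X] indep by simp
  qed
  then have "weak_conv_m (\<lambda>n. distr M borel (\<lambda>\<omega>. (\<Sum>i<n. X (Suc i) \<omega>) / sqrt (n * (sqrt (1 - \<rho>))\<^sup>2)))
      std_normal_distribution"
    using \<rho> by (intro central_limit_theorem_zero_mean[where \<mu> = "distr M borel (X 1)"])
      (auto simp: expectation_X intro: distr_X)
  moreover have "sqrt (n * (sqrt (1 - \<rho>))\<^sup>2) = sd n (\<lambda>_. 1)" for n
    using \<rho> by (simp add: sd_def mult.commute)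
  moreover have "(\<Sum>i<n. X (Suc i) \<omega>) = S n (\<lambda>_. 1) \<omega>" for n \<omega>
    by (simp add: S_def sum.atLeast1_atMost_eq)
  ultimately show ?thesis by simp
qed

text \<open>The inequality is tested on equal coefficients: the normalized sums have moments of
  order \<open>p\<close> at most \<open>C powr p\<close>, and this bound passes to the weak limit
  through the truncated moments.\<close>

lemma lp_norm_le_khinchine_constant:
  assumes p: "3 \<le> p" and C: "khinchine_constant M X p C"
  shows "lp_norm std_normal_distribution p (\<lambda>x. x) \<le> C"
proof -
  let ?S = "\<lambda>n. S n (\<lambda>_. 1)" and ?s = "\<lambda>n. sd n (\<lambda>_. 1)"
  have s: "0 < ?s n" if "1 \<le> n" for n
    using that \<rho> by (simp add: sd_def)
  have C_le: "N_norm M X p n (\<lambda>_. 1) \<le> C * ?s n" if "1 \<le> n" for n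
    using C that by (simp add: khinchine_constant_def N_norm_2)
  \<comment> \<open>\<open>C\<close> is an arbitrary real; its sign, needed for the manipulations
    with \<open>powr\<close>, comes from \<open>n = 1\<close>, where \<open>sd\<close> is
    positive.\<close>
  have "0 \<le> N_norm M X p 1 (\<lambda>_. 1)" by (simp add: N_norm_eq)
  then have C0: "0 \<le> C"
    using C_le[of 1] s[of 1] by (metis order.refl order_trans zero_le_mult_iff not_less)
  have bound: "expectation (\<lambda>\<omega>. \<bar>?S n \<omega> / ?s n\<bar> powr p) \<le> C powr p" if n: "1 \<le> n" for n
  proof -
    let ?E = "expectation (\<lambda>\<omega>. \<bar>?S n \<omega>\<bar> powr p)"
    have E0: "0 \<le> ?E" by (intro integral_nonneg_AE) auto
    have "?E = (?E powr (1 / p)) powr p"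
      using p E0 by (simp add: powr_powr)
    also have "\<dots> \<le> (C * ?s n) powr p"
      using C_le[OF n] p by (intro powr_mono2) (auto simp: N_norm_eq)
    also have "\<dots> = C powr p * ?s n powr p"
      using C0 s[OF n] by (simp add: powr_mult)
    finally have "?E / ?s n powr p \<le> C powr p"
      using s[OF n] by (simp add: divide_le_eq)
    moreover have "\<bar>?S n \<omega> / ?s n\<bar> powr p = \<bar>?S n \<omega>\<bar> powr p / ?s n powr p" for \<omega>
      using s[OF n] by (simp add: powr_divide)
    ultimately show ?thesis by simp
  qed
  have cont: "isCont (\<lambda>x. min (\<bar>x\<bar> powr p) (real k)) x" for k :: nat and x :: real
  proof -
    have "continuous_on UNIV (\<lambda>x :: real. min (\<bar>x\<bar> powr p) (real k))"
      using p by (intro continuous_intros continuous_on_powr') auto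
    then show ?thesis by (simp add: continuous_on_eq_continuous_at)
  qed
  have le: "(\<integral>x. min (\<bar>x\<bar> powr p) (real k) \<partial>std_normal_distribution) \<le> C powr p" for k :: nat
  proof (rule tendsto_upperbound)
    show "(\<lambda>n. \<integral>x. min (\<bar>x\<bar> powr p) (real k) \<partial>distr M borel (\<lambda>\<omega>. ?S n \<omega> / ?s n))
        \<longlonglongrightarrow> (\<integral>x. min (\<bar>x\<bar> powr p) (real k) \<partial>std_normal_distribution)"
      using real_distribution_distr std_normal.real_distribution_axioms
      by (intro weak_conv_imp_integral_bdd_continuous_conv[where B = "real k"] weak_conv_S cont) auto
    have "(\<integral>x. min (\<bar>x\<bar> powr p) (real k) \<partial>distr M borel (\<lambda>\<omega>. ?S n \<omega> / ?s n)) \<le> C powr p"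
      if n: "1 \<le> n" for n
    proof -
      \<comment> \<open>Without integrability the expectation on the right could be the default 0,
        and monotonicity of the integral would not apply.\<close>
      have "integrable M (\<lambda>\<omega>. \<bar>?S n \<omega>\<bar> powr p / ?s n powr p)"
        using expectation_S_powr_le(1)[OF p] by (intro integrable_divide) auto
      then have "integrable M (\<lambda>\<omega>. \<bar>?S n \<omega> / ?s n\<bar> powr p)"
        using s[OF n] by (simp add: powr_divide)
      then have "(\<integral>\<omega>. min (\<bar>?S n \<omega> / ?s n\<bar> powr p) (real k) \<partial>M) \<le> expectation (\<lambda>\<omega>. \<bar>?S n \<omega> / ?s n\<bar> powr p)"
        by (intro integral_mono integrable_min) auto
      with bound[OF n] show ?thesis by (simp add: integral_distr)
    qed
    then show "\<forall>\<^sub>F n in sequentially.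
        (\<integral>x. min (\<bar>x\<bar> powr p) (real k) \<partial>distr M borel (\<lambda>\<omega>. ?S n \<omega> / ?s n)) \<le> C powr p"
      by (auto simp: eventually_sequentially)
  qed auto
  have "(\<integral>x. \<bar>x\<bar> powr p \<partial>std_normal_distribution) \<le> C powr p"
    using p le by (intro tendsto_upperbound[OF expectation_min_abs_powr_tendsto]) auto
  then have "lp_norm std_normal_distribution p (\<lambda>x. x) \<le> (C powr p) powr (1 / p)"
    unfolding lp_norm_def using p by (intro powr_mono2) (auto intro!: integral_nonneg_AE)
  then show ?thesis
    using p C0 by (simp add: powr_powr)
qed

end

theorem corollary2:
  fixes M :: "'a measure" and X :: "nat \<Rightarrow> 'a \<Rightarrow> real"
    and N :: "'b measure" and G :: "'b \<Rightarrow> real"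
    and \<rho>\<^sub>0 p :: real
  assumes "0 \<le> \<rho>\<^sub>0" and "\<rho>\<^sub>0 \<le> 1 / 2"
    and "prob_space M"
    and "prob_space.indep_vars M (\<lambda>_. borel) X {1..}"
    and "\<And>i. i \<ge> 1 \<Longrightarrow> \<P>(\<omega> in M. X i \<omega> = 0) = \<rho>\<^sub>0"
    and "\<And>i. i \<ge> 1 \<Longrightarrow> \<P>(\<omega> in M. X i \<omega> = 1) = (1 - \<rho>\<^sub>0) / 2"
    and "\<And>i. i \<ge> 1 \<Longrightarrow> \<P>(\<omega> in M. X i \<omega> = -1) = (1 - \<rho>\<^sub>0) / 2"
    and "prob_space N"
    and "distributed N lborel G std_normal_density"
    and "p \<ge> 3"
  shows "best_khinchine_constant M X p (lp_norm N p G)"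
proof -
  interpret prob_space M by fact
  interpret lazy_signs M X \<rho>\<^sub>0
    using assms by unfold_locales auto
  \<comment> \<open>The norm depends only on the law of \<open>G\<close>, so the space
    \<open>N\<close> can be replaced by the real line with the standard Gaussian law.\<close>
  have "lp_norm N p G = lp_norm std_normal_distribution p (\<lambda>x. x)"
    using distributed_integral[OF assms(9), of "\<lambda>x. \<bar>x\<bar> powr p"]
    by (simp add: lp_norm_def integral_real_density)
  then show ?thesis
    using N_norm_le[OF \<open>p \<ge> 3\<close>] lp_norm_le_khinchine_constant[OF \<open>p \<ge> 3\<close>]
    by (auto simp: best_khinchine_constant_def khinchine_constant_def[of _ _ _ "lp_norm std_normal_distribution p (\<lambda>x. x)"])
qed

end
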